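(* For every $n\ge1$, every polyomino with $n$ tiles admits at most $\lceil n/2\rceil$ non-attacking rooks, and there exists a polyomino with $n$ tiles admitting $\lceil n/2\rceil$ non-attacking rooks. That is, the maximum number of non-attacking rooks that can be placed on a polyomino with $n$ tiles is $\lceil n/2\rceil$.
   Context: A polyomino is a finite union of unit squares (tiles) of the standard grid in $\mathbb{R}^2$ with connected interior. Two tiles of $P$ are in the same row (resp. column) of $P$ if the segment joining their centers is horizontal (resp. vertical) and contained in $P$. A set of rooks on distinct tiles is non-attacking if no two are in the same row or column of $P$. *)

theory Defs
  imports "HOL-Analysis.Analysis"
begin

text \<open>A unit square of the standard grid is named by its lower left corner.\<close>

definition tile :: "int \<times> int \<Rightarrow> (real \<times> real) set" where
  "tile c = {real_of_int (fst c)..real_of_int (fst c) + 1} \<times>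
            {real_of_int (snd c)..real_of_int (snd c) + 1}"

definition center :: "int \<times> int \<Rightarrow> real \<times> real" where
  "center c = (real_of_int (fst c) + 1 / 2, real_of_int (snd c) + 1 / 2)"

definition polyomino :: "(real \<times> real) set \<Rightarrow> bool" where
  "polyomino P \<longleftrightarrow>
     (\<exists>T. finite T \<and> P = (\<Union>c\<in>T. tile c)) \<and> connected (interior P)"

text \<open>A polyomino determines the grid squares it is the union of: they are exactly
  the ones it contains, because distinct grid squares have disjoint interiors.\<close>

definition tiles :: "(real \<times> real) set \<Rightarrow> (int \<times> int) set" where
  "tiles P = {c. tile c \<subseteq> P}"

definition same_row :: "(real \<times> real) set \<Rightarrow> int \<times> int \<Rightarrow> int \<times> int \<Rightarrow> bool" where
  "same_row P c d \<longleftrightarrow>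
     snd (center c) = snd (center d) \<and> closed_segment (center c) (center d) \<subseteq> P"

definition same_column :: "(real \<times> real) set \<Rightarrow> int \<times> int \<Rightarrow> int \<times> int \<Rightarrow> bool" where
  "same_column P c d \<longleftrightarrow>
     fst (center c) = fst (center d) \<and> closed_segment (center c) (center d) \<subseteq> P"

text \<open>A placement of rooks on distinct tiles is the set of the tiles they occupy.\<close>

definition non_attacking :: "(real \<times> real) set \<Rightarrow> (int \<times> int) set \<Rightarrow> bool" where
  "non_attacking P R \<longleftrightarrow>
     R \<subseteq> tiles P \<and>
     (\<forall>c\<in>R. \<forall>d\<in>R. c \<noteq> d \<longrightarrow> \<not> same_row P c d \<and> \<not> same_column P c d)"

end

theory Submission
  imports Defs
begin

text \<open>Each tile lies in one maximal horizontal segment (row) and one maximal vertical segment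
  (column). Regard rows and columns as the vertices of a bipartite graph whose edges are the
  tiles. Connectedness of the interior makes this graph connected, so with \<open>n\<close> edges it has at
  most \<open>n + 1\<close> vertices. Non-attacking rooks form a matching, hence twice their number is at
  most \<open>n + 1\<close>. The bound is attained on a staircase with a rook on every other tile.\<close>

subsection \<open>Grid squares\<close>

lemma mem_tile_iff:
  "(u, v) \<in> tile c \<longleftrightarrow> of_int (fst c) \<le> u \<and> u \<le> of_int (fst c) + 1 \<and>
     of_int (snd c) \<le> v \<and> v \<le> of_int (snd c) + 1"
  by (auto simp: tile_def)

lemma interior_tile:
  "interior (tile c) = {real_of_int (fst c)<..<real_of_int (fst c) + 1} \<times>
            {real_of_int (snd c)<..<real_of_int (snd c) + 1}"
  by (simp add: tile_def interior_Times interior_atLeastAtMost_real)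

text \<open>A tile is regular closed, so what is known on its open square passes to the whole tile
  by closure.\<close>

lemma closure_interior_tile: "closure (interior (tile c)) = tile c"
  unfolding interior_tile closure_Times by (simp add: tile_def)

lemma closed_tile: "closed (tile c)"
  by (metis closed_closure closure_interior_tile)

lemma center_in_interior: "center c \<in> interior (tile c)"
  by (simp add: interior_tile center_def)

lemma interior_tile_Int_tile:
  assumes "p \<in> interior (tile c)" "p \<in> tile d"
  shows "c = d"
proof -
  obtain u v where p: "p = (u, v)" by (cases p)
  have "real_of_int (fst c) < of_int (fst d) + 1" "real_of_int (fst d) < of_int (fst c) + 1"
    "real_of_int (snd c) < of_int (snd d) + 1" "real_of_int (snd d) < of_int (snd c) + 1"
    using assms unfolding p interior_tile mem_tile_iff by auto
  then have "fst c = fst d" "snd c = snd d" by linarith+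
  then show ?thesis by (rule prod_eqI)
qed

text \<open>The center of a tile lies in no other tile. Hence the family witnessing
  \<open>polyomino P\<close> can only be \<open>tiles P\<close>.\<close>

lemma tiles_Union: "tiles (\<Union>c\<in>T. tile c) = T"
proof
  show "tiles (\<Union>c\<in>T. tile c) \<subseteq> T"
  proof
    fix c assume "c \<in> tiles (\<Union>c\<in>T. tile c)"
    then have "center c \<in> (\<Union>c\<in>T. tile c)"
      using center_in_interior interior_subset unfolding tiles_def by blast
    then show "c \<in> T"
      using interior_tile_Int_tile[OF center_in_interior] by blast
  qed
qed (auto simp: tiles_def)

lemma polyomino_eq_Union_tiles:
  assumes "polyomino P"
  shows "finite (tiles P)" "P = (\<Union>c\<in>tiles P. tile c)" "connected (interior P)"
  using assms unfolding polyomino_def by (auto simp: tiles_Union)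

text \<open>Since \<open>p\<close> is in the closure of the open square of \<open>c\<close>, the
  neighbourhood \<open>interior P\<close> meets that square, and a point there is covered by no tile
  other than \<open>c\<close>.\<close>

lemma tile_at_interior_point:
  assumes P: "P = (\<Union>c\<in>T. tile c)" and "p \<in> interior P" "p \<in> tile c"
  shows "c \<in> T"
proof -
  have "p \<in> interior P \<inter> closure (interior (tile c))"
    using assms closure_interior_tile by simp
  then have "interior P \<inter> interior (tile c) \<noteq> {}"
    using open_Int_closure_eq_empty[OF open_interior] by fast
  then obtain q where "q \<in> P" "q \<in> interior (tile c)"
    using interior_subset by blast
  then show ?thesis
    using interior_tile_Int_tile P by blast
qed

subsection \<open>Adjacent tiles\<close>

definition adjacent :: "int \<times> int \<Rightarrow> int \<times> int \<Rightarrow> bool" where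
  "adjacent c d \<longleftrightarrow> fst c = fst d \<and> \<bar>snd c - snd d\<bar> = 1 \<or> snd c = snd d \<and> \<bar>fst c - fst d\<bar> = 1"

section \<open>Rows and columns as equivalence relations\<close>

lemma closed_segment_horizontal:
  fixes a b y :: real
  shows "closed_segment (a, y) (b, y) = closed_segment a b \<times> {y}"
proof -
  have "linear (\<lambda>x::real. (x, 0::real))"
    by (auto intro!: linearI)
  then have "closed_segment (a, 0::real) (b, 0) = (\<lambda>x. (x, 0)) ` closed_segment a b"
    by (rule closed_segment_linear_image)
  then have "(+) (0, y) ` closed_segment (a, 0) (b, 0) = closed_segment a b \<times> {y}"
    by (force simp: image_iff)
  then show ?thesis
    by (simp flip: closed_segment_translation)
qed

lemma closed_segment_vertical:
  fixes a b x :: real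
  shows "closed_segment (x, a) (x, b) = {x} \<times> closed_segment a b"
proof -
  have "linear (\<lambda>y::real. (0::real, y))"
    by (auto intro!: linearI)
  then have "closed_segment (0::real, a) (0, b) = (\<lambda>y. (0, y)) ` closed_segment a b"
    by (rule closed_segment_linear_image)
  then have "(+) (x, 0) ` closed_segment (0, a) (0, b) = {x} \<times> closed_segment a b"
    by (force simp: image_iff)
  then show ?thesis
    by (simp flip: closed_segment_translation)
qed

lemma same_row_iff:
  "same_row P c d \<longleftrightarrow> snd c = snd d \<and>
     closed_segment (real_of_int (fst c) + 1 / 2) (real_of_int (fst d) + 1 / 2) \<times>
       {real_of_int (snd c) + 1 / 2} \<subseteq> P"
  unfolding same_row_def center_def by (auto simp: closed_segment_horizontal)

lemma same_column_iff:
  "same_column P c d \<longleftrightarrow> fst c = fst d \<and>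
     {real_of_int (fst c) + 1 / 2} \<times>
       closed_segment (real_of_int (snd c) + 1 / 2) (real_of_int (snd d) + 1 / 2) \<subseteq> P"
  unfolding same_column_def center_def by (auto simp: closed_segment_vertical)

lemma same_row_refl: "c \<in> tiles P \<Longrightarrow> same_row P c c"
  using center_in_interior[of c] interior_subset[of "tile c"]
  by (auto simp: same_row_def tiles_def)

lemma same_column_refl: "c \<in> tiles P \<Longrightarrow> same_column P c c"
  using center_in_interior[of c] interior_subset[of "tile c"]
  by (auto simp: same_column_def tiles_def)

lemma same_row_sym: "same_row P c d \<Longrightarrow> same_row P d c"
  by (auto simp: same_row_def closed_segment_commute)

lemma same_column_sym: "same_column P c d \<Longrightarrow> same_column P d c"
  by (auto simp: same_column_def closed_segment_commute)

text \<open>Nothing is assumed about the order of the points: for transitivity, the middle tile need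
  not lie between the other two.\<close>

lemma closed_segment_real_subset_Un:
  fixes a b c :: real
  shows "closed_segment a c \<subseteq> closed_segment a b \<union> closed_segment b c"
  by (auto simp: closed_segment_eq_real_ivl split: if_splits)

lemma same_row_trans:
  assumes "same_row P c d" "same_row P d e"
  shows "same_row P c e"
proof -
  have *: "A \<times> D \<subseteq> P" if "A \<subseteq> B \<union> C" "B \<times> D \<subseteq> P" "C \<times> D \<subseteq> P"
    for A B C :: "real set" and D :: "real set"
    using that by blast
  show ?thesis
    using assms unfolding same_row_iff
    by (metis *[OF closed_segment_real_subset_Un])
qed

lemma same_column_trans:
  assumes "same_column P c d" "same_column P d e"
  shows "same_column P c e"
proof -
  have *: "D \<times> A \<subseteq> P" if "A \<subseteq> B \<union> C" "D \<times> B \<subseteq> P" "D \<times> C \<subseteq> P"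
    for A B C :: "real set" and D :: "real set"
    using that by blast
  show ?thesis
    using assms unfolding same_column_iff
    by (metis *[OF closed_segment_real_subset_Un])
qed

lemma adjacent_same_line:
  assumes "c \<in> tiles P" "d \<in> tiles P" "adjacent c d"
  shows "same_row P c d \<or> same_column P c d"
proof -
  have sub: "tile c \<union> tile d \<subseteq> P"
    using assms by (auto simp: tiles_def)
  show ?thesis
  proof (cases "fst c = fst d")
    case True
    then have "{real_of_int (fst c) + 1 / 2} \<times>
       closed_segment (real_of_int (snd c) + 1 / 2) (real_of_int (snd d) + 1 / 2)
       \<subseteq> tile c \<union> tile d"
      using \<open>adjacent c d\<close>
      by (auto simp: adjacent_def mem_tile_iff closed_segment_eq_real_ivl abs_if split: if_splits)
    with True sub show ?thesis by (auto simp: same_column_iff)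
  next
    case False
    then have row: "snd c = snd d" "\<bar>fst c - fst d\<bar> = 1"
      using \<open>adjacent c d\<close> by (auto simp: adjacent_def)
    then have "closed_segment (real_of_int (fst c) + 1 / 2) (real_of_int (fst d) + 1 / 2) \<times>
       {real_of_int (snd c) + 1 / 2} \<subseteq> tile c \<union> tile d"
      by (auto simp: mem_tile_iff closed_segment_eq_real_ivl abs_if split: if_splits)
    with row sub show ?thesis by (auto simp: same_row_iff)
  qed
qed

text \<open>The discrete form of connectedness. Tiles inside and outside \<open>S\<close> form two
  closed sets covering the connected interior of \<open>P\<close>, so they meet at an interior
  point; contact in a corner there is resolved through a third tile.\<close>

lemma polyomino_adjacent_exit:
  assumes P: "polyomino P" and S: "S \<subset> tiles P" "S \<noteq> {}"
  obtains c d where "c \<in> S" "d \<in> tiles P - S" "adjacent c d"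
proof -
  note poly = polyomino_eq_Union_tiles[OF P]
  define U where "U = (\<Union>c\<in>S. tile c)"
  define V where "V = (\<Union>c\<in>tiles P - S. tile c)"
  have closed: "closed U" "closed V"
    unfolding U_def V_def using poly(1) S(1) finite_subset
    by (auto intro!: closed_UN closed_tile)
  have cover: "interior P \<subseteq> U \<union> V"
    using poly(2) interior_subset[of P] unfolding U_def V_def by blast
  have meets: "W \<inter> interior P \<noteq> {}" if A: "W = (\<Union>c\<in>A. tile c)" "A \<subseteq> tiles P" "A \<noteq> {}" for W A
  proof -
    obtain c where "c \<in> A" using A by blast
    then have "center c \<in> W" "center c \<in> interior P"
      using A center_in_interior[of c] interior_subset[of "tile c"] interior_mono[of "tile c" P]
      by (auto simp: tiles_def)
    then show ?thesis by blast
  qed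
  have "U \<inter> interior P \<noteq> {}" "V \<inter> interior P \<noteq> {}"
    using meets[of U S] meets[of V "tiles P - S"] S unfolding U_def V_def by blast+
  then have "U \<inter> V \<inter> interior P \<noteq> {}"
    using poly(3) closed cover unfolding connected_closed by blast
  then obtain p a b where p: "p \<in> interior P" "p \<in> tile a" "p \<in> tile b"
    and ab: "a \<in> S" "b \<in> tiles P - S"
    unfolding U_def V_def by blast
  obtain u v where uv: "p = (u, v)" by (cases p)
  \<comment> \<open>If \<open>a\<close> and \<open>b\<close> touch only in a corner, this square belongs to \<open>P\<close> and is adjacent to both.\<close>
  define c where "c = (fst a, snd b)"
  have "p \<in> tile c"
    using p unfolding uv c_def mem_tile_iff by auto
  then have c: "c \<in> tiles P"
    using tile_at_interior_point[OF poly(2) p(1)] by blast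
  have "real_of_int (fst a) \<le> of_int (fst b) + 1" "real_of_int (fst b) \<le> of_int (fst a) + 1"
    "real_of_int (snd a) \<le> of_int (snd b) + 1" "real_of_int (snd b) \<le> of_int (snd a) + 1"
    using p unfolding uv mem_tile_iff by auto
  then have "\<bar>fst a - fst b\<bar> \<le> 1" "\<bar>snd a - snd b\<bar> \<le> 1" by linarith+
  then have "a = c \<or> adjacent a c" "c = b \<or> adjacent c b"
    unfolding adjacent_def c_def prod_eq_iff by auto
  \<comment> \<open>If \<open>c\<close> lies in \<open>S\<close>, the pair is \<open>c\<close>,
    \<open>b\<close>; otherwise it is \<open>a\<close>, \<open>c\<close>.\<close>
  then show ?thesis
    using that ab c by blast
qed

subsection \<open>Upper bound\<close>

text \<open>Equivalence classes stand for the rows, and below for the columns, so that these can be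
  counted as images of \<open>tiles P\<close>.\<close>

definition row_of :: "(real \<times> real) set \<Rightarrow> int \<times> int \<Rightarrow> (int \<times> int) set" where
  "row_of P c = {d. same_row P c d}"

definition column_of :: "(real \<times> real) set \<Rightarrow> int \<times> int \<Rightarrow> (int \<times> int) set" where
  "column_of P c = {d. same_column P c d}"

lemma row_of_eq: "same_row P c d \<Longrightarrow> row_of P c = row_of P d"
  unfolding row_of_def using same_row_sym same_row_trans by blast

lemma column_of_eq: "same_column P c d \<Longrightarrow> column_of P c = column_of P d"
  unfolding column_of_def using same_column_sym same_column_trans by blast

text \<open>A connected graph has at most one vertex more than edges. The tiles are collected one by
  one: the first brings one row and one column, and each later one, adjacent to a tile already
  present, brings at most one new line.\<close>

lemma card_rows_columns_le:
  assumes P: "polyomino P" and ne: "tiles P \<noteq> {}"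
  shows "card (row_of P ` tiles P) + card (column_of P ` tiles P) \<le> card (tiles P) + 1"
proof -
  note fin = polyomino_eq_Union_tiles(1)[OF P]
  have "\<exists>S\<subseteq>tiles P. card S = k \<and> card (row_of P ` S) + card (column_of P ` S) \<le> k + 1"
    if "1 \<le> k" "k \<le> card (tiles P)" for k
    using that
  proof (induction k rule: dec_induct)
    case base
    from ne obtain c where "c \<in> tiles P" by blast
    then show ?case by (intro exI[of _ "{c}"]) auto
  next
    case (step k)
    then obtain S where S: "S \<subseteq> tiles P" "card S = k"
      and le: "card (row_of P ` S) + card (column_of P ` S) \<le> k + 1"
      by auto
    have "S \<subset> tiles P" "S \<noteq> {}" "finite S"
      using S step fin finite_subset by auto
    then obtain c d where cd: "c \<in> S" "d \<in> tiles P - S" "adjacent c d"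
      using polyomino_adjacent_exit[OF P] by metis
    then have "same_row P c d \<or> same_column P c d"
      using adjacent_same_line S by blast
    then have "row_of P d \<in> row_of P ` S \<or> column_of P d \<in> column_of P ` S"
      using row_of_eq column_of_eq cd(1) by blast
    \<comment> \<open>Used for both \<open>row_of P\<close> and \<open>column_of P\<close>: one of
      the two counts stays the same, the other grows by at most one.\<close>
    moreover have "card (f ` insert d S) \<le> Suc (card (f ` S))"
      "f d \<in> f ` S \<Longrightarrow> card (f ` insert d S) = card (f ` S)" for f :: "_ \<Rightarrow> (int \<times> int) set"
      using \<open>finite S\<close> by (simp_all add: card_insert_if insert_absorb)
    ultimately have "card (row_of P ` insert d S) + card (column_of P ` insert d S) \<le> Suc k + 1"
      using le by (smt (verit) add_Suc add_Suc_right add_le_mono le_trans le_refl Suc_le_mono)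
    moreover have "insert d S \<subseteq> tiles P" "card (insert d S) = Suc k"
      using cd S \<open>finite S\<close> by auto
    ultimately show ?case by blast
  qed
  from this[of "card (tiles P)"] obtain S where "S \<subseteq> tiles P" "card S = card (tiles P)"
    and le: "card (row_of P ` S) + card (column_of P ` S) \<le> card (tiles P) + 1"
    using ne fin by (auto simp: Suc_le_eq card_gt_0_iff)
  then have "S = tiles P"
    using fin card_subset_eq by blast
  with le show ?thesis by simp
qed

text \<open>Rooks occupy pairwise distinct rows and pairwise distinct columns, so
  \<open>card R\<close> is at most each of the two counts just bounded in sum.\<close>

lemma non_attacking_card_le:
  assumes P: "polyomino P" and ne: "tiles P \<noteq> {}" and R: "non_attacking P R"
  shows "2 * card R \<le> card (tiles P) + 1"
proof -
  note fin = polyomino_eq_Union_tiles(1)[OF P]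
  have sub: "R \<subseteq> tiles P"
    and na: "\<And>c d. c \<in> R \<Longrightarrow> d \<in> R \<Longrightarrow> same_row P c d \<or> same_column P c d \<Longrightarrow> c = d"
    using R unfolding non_attacking_def by blast+
  have "inj_on (row_of P) R" "inj_on (column_of P) R"
    using sub na same_row_refl same_column_refl
    unfolding inj_on_def row_of_def column_of_def by blast+
  then have "card R \<le> card (row_of P ` tiles P)" "card R \<le> card (column_of P ` tiles P)"
    using sub fin card_inj_on_le[of "row_of P" R] card_inj_on_le[of "column_of P" R]
    by (simp_all add: image_mono)
  with card_rows_columns_le[OF P ne] show ?thesis by linarith
qed

subsection \<open>The staircase\<close>

text \<open>Steps alternate right and up: (0,0), (1,0), (1,1), (2,1), ... The coordinates of tile
  \<open>i\<close> add up to \<open>i\<close>.\<close>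

definition stair :: "nat \<Rightarrow> int \<times> int" where
  "stair i = (int (Suc i div 2), int (i div 2))"

definition staircase :: "nat \<Rightarrow> (real \<times> real) set" where
  "staircase n = (\<Union>i<n. tile (stair i))"

lemma inj_stair: "inj stair"
proof (rule injI)
  fix i j assume "stair i = stair j"
  then have "Suc i div 2 + i div 2 = Suc j div 2 + j div 2"
    unfolding stair_def by (metis Pair_inject of_nat_eq_iff)
  moreover have "Suc k div 2 + k div 2 = k" for k
    by linarith
  ultimately show "i = j" by simp
qed

lemma adjacent_stair: "adjacent (stair i) (stair (Suc i))"
  unfolding adjacent_def stair_def by (cases "even i") auto

lemma connected_interior_adjacent:
  assumes "adjacent c d"
  shows "connected (interior (tile c \<union> tile d))"
proof -
  \<comment> \<open>The bounding rectangle of the two tiles; adjacency makes them fill it, and a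
    rectangle is convex.\<close>
  define H where "H = {real_of_int (min (fst c) (fst d))..real_of_int (max (fst c) (fst d)) + 1} \<times>
    {real_of_int (min (snd c) (snd d))..real_of_int (max (snd c) (snd d)) + 1}"
  have "tile c \<union> tile d = H"
  proof (rule set_eqI)
    fix p :: "real \<times> real"
    obtain u v where "p = (u, v)" by (cases p)
    with assms show "p \<in> tile c \<union> tile d \<longleftrightarrow> p \<in> H"
      unfolding adjacent_def H_def
      by (auto simp: mem_tile_iff abs_if min_def max_def split: if_splits)
  qed
  moreover have "convex H"
    unfolding H_def by (intro convex_Times convex_real_interval)
  ultimately show ?thesis
    by (simp add: convex_connected convex_interior)
qed

text \<open>A connected set between the open tiles and the interior avoids computing that interior
  exactly. It grows by the interiors of two-tile rectangles, each overlapping the set built so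
  far.\<close>

lemma staircase_core:
  assumes "n \<ge> 1"
  shows "\<exists>S. connected S \<and> (\<Union>i<n. interior (tile (stair i))) \<subseteq> S \<and> S \<subseteq> interior (staircase n)"
  using assms
proof (induction n rule: dec_induct)
  case base
  have "connected (interior (tile (stair 0)))"
    by (simp add: tile_def convex_connected convex_interior convex_Times)
  then show ?case
    by (intro exI[of _ "interior (tile (stair 0))"]) (simp add: staircase_def lessThan_Suc)
next
  case (step n)
  then obtain S where S: "connected S" "(\<Union>i<n. interior (tile (stair i))) \<subseteq> S"
    "S \<subseteq> interior (staircase n)"
    by blast
  obtain m where m: "n = Suc m" using step by (cases n) auto
  define B where "B = interior (tile (stair m) \<union> tile (stair n))"
  have sub: "interior (tile (stair m)) \<subseteq> B" "interior (tile (stair n)) \<subseteq> B"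
    unfolding B_def by (auto intro: interior_mono[THEN subsetD, rotated])
  have "interior (tile (stair m)) \<subseteq> S"
    using S(2) m by blast
  then have "S \<inter> B \<noteq> {}"
    using sub(1) center_in_interior by blast
  then have "connected (S \<union> B)"
    using S(1) connected_interior_adjacent adjacent_stair m unfolding B_def
    by (intro connected_Un) auto
  moreover have "(\<Union>i<Suc n. interior (tile (stair i))) \<subseteq> S \<union> B"
    using S(2) sub(2) by (auto simp: lessThan_Suc)
  moreover have "S \<union> B \<subseteq> interior (staircase (Suc n))"
  proof -
    have "staircase n \<subseteq> staircase (Suc n)"
      "tile (stair m) \<union> tile (stair n) \<subseteq> staircase (Suc n)"
      unfolding staircase_def m lessThan_Suc by auto
    then show ?thesis
      using S(3) interior_mono unfolding B_def by blast
  qed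
  ultimately show ?case by blast
qed

lemma polyomino_staircase:
  assumes "n \<ge> 1"
  shows "polyomino (staircase n)"
proof -
  obtain S where S: "connected S" "(\<Union>i<n. interior (tile (stair i))) \<subseteq> S"
    "S \<subseteq> interior (staircase n)"
    using staircase_core[OF assms] by blast
  \<comment> \<open>The interior is thus squeezed between the connected set \<open>S\<close> and its
    closure, hence connected.\<close>
  have "tile (stair i) \<subseteq> closure S" if "i < n" for i
    using that S(2) closure_interior_tile closure_mono[of "interior (tile (stair i))" S] by blast
  then have "interior (staircase n) \<subseteq> closure S"
    using interior_subset[of "staircase n"] unfolding staircase_def by blast
  then have "connected (interior (staircase n))"
    using connected_intermediate_closure S by blast
  moreover have "staircase n = (\<Union>c\<in>stair ` {..<n}. tile c)"
    by (simp add: staircase_def)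
  ultimately show ?thesis
    unfolding polyomino_def by blast
qed

lemma tiles_staircase: "tiles (staircase n) = stair ` {..<n}"
  using tiles_Union[of "stair ` {..<n}"] by (simp add: staircase_def)

lemma card_tiles_staircase: "card (tiles (staircase n)) = n"
  by (simp add: tiles_staircase card_image inj_on_subset[OF inj_stair])

text \<open>Rooks go on the tiles of even index, which are the diagonal squares
  \<open>(k, k)\<close>; \<open>(n + 1) div 2\<close> counts the even numbers below
  \<open>n\<close>.\<close>

definition stair_rooks :: "nat \<Rightarrow> (int \<times> int) set" where
  "stair_rooks n = (\<lambda>k. stair (2 * k)) ` {..<(n + 1) div 2}"

lemma card_stair_rooks: "card (stair_rooks n) = (n + 1) div 2"
  unfolding stair_rooks_def by (subst card_image) (auto simp: inj_on_def stair_def)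

lemma non_attacking_stair_rooks: "non_attacking (staircase n) (stair_rooks n)"
  unfolding non_attacking_def
proof (intro conjI ballI impI)
  have "2 * k < n" if "k < (n + 1) div 2" for k
    using that by linarith
  then show "stair_rooks n \<subseteq> tiles (staircase n)"
    unfolding tiles_staircase stair_rooks_def by blast
next
  \<comment> \<open>Distinct diagonal squares differ in both coordinates.\<close>
  fix c d assume "c \<in> stair_rooks n" "d \<in> stair_rooks n" "c \<noteq> d"
  then show "\<not> same_row (staircase n) c d" "\<not> same_column (staircase n) c d"
    unfolding stair_rooks_def same_row_iff same_column_iff stair_def by auto
qed

section \<open>The exact maximum\<close>

lemma ceiling_half: "\<lceil>real n / 2\<rceil> = int ((n + 1) div 2)"
  by (rule ceiling_unique) linarith+

theorem theorem18:
  fixes n :: nat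
  assumes "n \<ge> 1"
  shows "(\<forall>P R. polyomino P \<and> card (tiles P) = n \<and> non_attacking P R \<longrightarrow>
              int (card R) \<le> \<lceil>real n / 2\<rceil>) \<and>
         (\<exists>P R. polyomino P \<and> card (tiles P) = n \<and> non_attacking P R \<and>
              int (card R) = \<lceil>real n / 2\<rceil>) \<and>
         int (Max {card R | P R. polyomino P \<and> card (tiles P) = n \<and> non_attacking P R}) =
           \<lceil>real n / 2\<rceil>"
proof -
  let ?C = "{card R | P R. polyomino P \<and> card (tiles P) = n \<and> non_attacking P R}"
  have upper: "card R \<le> (n + 1) div 2"
    if "polyomino P" "card (tiles P) = n" "non_attacking P R" for P R
  proof -
    have "tiles P \<noteq> {}" using that(2) assms by auto
    then have "2 * card R \<le> n + 1"
      using non_attacking_card_le that by blast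
    then show ?thesis by linarith
  qed
  have witness: "polyomino (staircase n)" "card (tiles (staircase n)) = n"
    "non_attacking (staircase n) (stair_rooks n)" "card (stair_rooks n) = (n + 1) div 2"
    using polyomino_staircase[OF assms] card_tiles_staircase non_attacking_stair_rooks
      card_stair_rooks by auto
  have "Max ?C = (n + 1) div 2"
  proof (rule Max_eqI)
    \<comment> \<open>The upper bound makes the set of rook counts finite, so \<open>Max\<close> is
      a genuine maximum even though infinitely many polyominoes are involved.\<close>
    have "?C \<subseteq> {..(n + 1) div 2}" using upper by auto
    then show "finite ?C" by (rule finite_subset) simp
    show "k \<le> (n + 1) div 2" if "k \<in> ?C" for k
      using that upper by auto
    show "(n + 1) div 2 \<in> ?C"
      using witness by (intro CollectI exI[of _ "staircase n"] exI[of _ "stair_rooks n"]) simp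
  qed
  moreover have "\<exists>P R. polyomino P \<and> card (tiles P) = n \<and> non_attacking P R \<and>
      card R = (n + 1) div 2"
    using witness by blast
  ultimately show ?thesis
    using upper unfolding ceiling_half of_nat_le_iff of_nat_eq_iff by (intro conjI) blast+
qed

end
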